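(* Let $(\kappa_r)_{r\ge1}$ be the unique integer sequence with $D(q)=\prod_{r\ge1}(1-q^r)^{\kappa_r}$ as formal power series. For every $r\ge1$, $$\kappa_r>0 .$$ The first values are $\kappa_1,\dots,\kappa_8=3,\,3,\,13,\,33,\,93,\,254,\,771,\,2292$. For every $R$ with $1/2<R<R_*$ and every $\rho$ satisfying $$\max\{R^{-1},q_0^{-1/2}\}<\rho<2,$$ one has $$\kappa_r=\frac{q_0^{-r}}r+O_{R,\rho}\left(\frac{\rho^r}{r}\right).$$
   Context: $D(q):=\sum_{k\ge0}(-1)^{T_k}(2k+1)q^{T_k}$ with $T_k=k(k+1)/2$, regarded as a formal power series in $\mathbb Z[[q]]$ with $D(0)=1$ and as a holomorphic function on $|q|<1$. The integers $\kappa_r$ in the formal product exist and are uniquely determined recursively. $D$ has exactly one zero $q_0$ in $|q|<1/2$; it is simple, real and positive, with $29/100<q_0<293/1000$. Define $$R_*:=\min\Bigl\{1,\ \inf\{|z|:|z|<1,\ D(z)=0,\ z\ne q_0\}\Bigr\},\qquad \inf\varnothing:=+\infty ;$$ one has $R_*\in(1/2,1]$. Subscripts on $O$ indicate the parameters on which the implied constant may depend. *)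

theory Defs
  imports
    "HOL-Analysis.Analysis"
    "HOL-Library.Landau_Symbols"
    "HOL-Library.Nat_Bijection"
begin

text \<open>
  The coefficient of \<open>q^n\<close> is written as a sum over all \<open>k\<close> with \<open>T_k = n\<close>; since
  \<open>triangle\<close> is injective, there is at most one such \<open>k\<close>.
\<close>

definition D_fps :: "'a::comm_ring_1 fps" where
  "D_fps = Abs_fps (\<lambda>n. \<Sum>k | triangle k = n. (-1) ^ triangle k * of_nat (2 * k + 1))"

definition D_fun :: "complex \<Rightarrow> complex" where
  "D_fun z = eval_fps D_fps z"

text \<open>
  \<open>D(q) = \<Prod>r\<ge>1. (1 - q^r)^(\<kappa> r)\<close>, with convergence in the \<open>q\<close>-adic topology. The identity is
  stated in \<open>\<complex>[[q]]\<close>, which contains \<open>\<int>[[q]]\<close>, because negative integer powers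
  are not available for \<open>int fps\<close>. The index of the product is shifted by one, so
  \<open>\<kappa> 0\<close> plays no role.
\<close>

definition product_exponents :: "(nat \<Rightarrow> int) \<Rightarrow> bool" where
  "product_exponents \<kappa> \<longleftrightarrow>
     (\<lambda>r. (1 - fps_X ^ Suc r) powi \<kappa> (Suc r)) has_prod (D_fps :: complex fps)"

text \<open>The condition \<open>\<kappa> 0 = 0\<close> only fixes the unused value at \<open>0\<close>, to make the choice unique.\<close>

definition kappa :: "nat \<Rightarrow> int" where
  "kappa = (THE \<kappa>. \<kappa> 0 = 0 \<and> product_exponents \<kappa>)"

text \<open>The only zero of \<open>D\<close> in the complex disc \<open>|z| < 1/2\<close>; it is real.\<close>

definition q0 :: real where
  "q0 = (THE x. {z. norm z < 1 / 2 \<and> D_fun z = 0} = {complex_of_real x})"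

text \<open>Extended reals are used so that the infimum of the empty set is \<open>\<infinity>\<close>.\<close>

definition R_star :: ereal where
  "R_star = min 1 (INF z\<in>{z. norm z < 1 \<and> D_fun z = 0 \<and> z \<noteq> complex_of_real q0}. ereal (norm z))"

end

theory Submission
  imports Defs "HOL-Complex_Analysis.Complex_Analysis"
begin

text \<open>
  Everything is read off from the logarithmic derivative \<open>-q D'(q) / D(q) = \<Sum>n a(n) q^n\<close>. Taking
  it factor by factor in \<open>D(q) = \<Prod>r (1 - q^r)^\<kappa>(r)\<close> gives \<open>a(n) = \<Sum>d|n d \<kappa>(d)\<close>
  (\<open>neg_log_deriv_D\<close>). As \<open>a\<close> determines \<open>\<kappa>\<close>, the exponents are unique; they exist because the factor
  with index \<open>r\<close> changes the coefficient of \<open>q^r\<close> by \<open>-\<kappa>(r)\<close> and leaves the lower ones alone, so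
  that the coefficients of \<open>D\<close> can be matched one at a time by integers.

  Positivity is elementary. The identity \<open>-q D' = D \<cdot> (-q D'/D)\<close> is a Newton-type recurrence
  \<open>a(n) = 3 a(n-1) + 5 a(n-3) - 7 a(n-6) - \<dots> - n c(n)\<close>, where \<open>c(n)\<close> is the coefficient of \<open>q^n\<close> in
  \<open>D\<close>. For \<open>n \<ge> 6\<close> the term \<open>5 a(n-3)\<close> outweighs all those after it; hence \<open>a(n) \<ge> 3 a(n-1)\<close>
  (\<open>divisor_sum_growth\<close>). Proper divisors of \<open>r\<close> are at most \<open>r div 2\<close>, so they contribute to \<open>a(r)\<close>
  at most \<open>\<Sum>d \<le> r/2. a(d) \<le> 2 a(r div 2) < a(r)\<close>. This shows \<open>\<kappa>(r) > 0\<close> and also \<open>r \<kappa>(r) = a(r) + O(a(r div 2))\<close> (\<open>exponent_pos_and_approx\<close>).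

  For the asymptotics, write \<open>D(z) = (z - q0) h(z)\<close>. The linear factor contributes exactly
  \<open>q0^(-n)\<close> to \<open>a(n)\<close>, and \<open>h\<close> has no zero of modulus less than \<open>R_star\<close>, so the rest is
  \<open>O(R^(-n))\<close> for every \<open>R < R_star\<close> (\<open>divisor_sum_asymptotics\<close>). With \<open>\<rho> > 1/R\<close> and
  \<open>\<rho>\<^sup>2 > 1/q0\<close>, both this error and \<open>a(r div 2) = O(q0^(-r/2))\<close> are \<open>O(\<rho>^r)\<close>.

  That \<open>D\<close> has exactly one zero \<open>q0\<close> in \<open>|z| < 1/2\<close>, and a simple one, needs no count of zeros by
  contour integrals: for \<open>|z| \<le> 1/2\<close> and \<open>|w| \<le> 293/1000\<close> the linear term of \<open>D(z) - D(w)\<close>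
  dominates, whence \<open>|z - w| \<le> 50 |D(z) - D(w)|\<close> (\<open>D_fun_diff_bound\<close>). A real zero in
  \<open>(0, 293/1000]\<close> exists by the intermediate value theorem.
\<close>

section \<open>Logarithmic derivatives of formal power series\<close>

text \<open>
  \<open>L = -X f' / f\<close>, stated without division. The sign makes the contribution of \<open>1 - X^r\<close> a power
  series with nonnegative coefficients.
\<close>

definition neg_log_deriv :: "'a::comm_ring_1 fps \<Rightarrow> 'a fps \<Rightarrow> bool" where
  "neg_log_deriv f L \<longleftrightarrow> - (fps_X * fps_deriv f) = f * L"

lemma neg_theta_nth: "fps_nth (- (fps_X * fps_deriv f)) n = - of_nat n * fps_nth f n"
  for f :: "'a::comm_ring_1 fps"
  by (cases n) (simp_all add: algebra_simps)

lemma neg_log_deriv_1: "neg_log_deriv 1 0"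
  by (simp add: neg_log_deriv_def)

lemma neg_log_deriv_mult:
  assumes "neg_log_deriv f L" "neg_log_deriv g M"
  shows "neg_log_deriv (f * g) (L + M)"
proof -
  have "- (fps_X * fps_deriv (f * g))
      = f * (- (fps_X * fps_deriv g)) + g * (- (fps_X * fps_deriv f))"
    by (simp add: algebra_simps)
  also have "\<dots> = (f * g) * (L + M)"
    using assms by (simp add: neg_log_deriv_def algebra_simps)
  finally show ?thesis
    by (simp add: neg_log_deriv_def)
qed

lemma neg_log_deriv_prod:
  assumes "\<And>i. i \<in> A \<Longrightarrow> neg_log_deriv (f i) (L i)"
  shows "neg_log_deriv (\<Prod>i\<in>A. f i) (\<Sum>i\<in>A. L i)"
  using assms
  by (induction A rule: infinite_finite_induct)
     (auto intro!: neg_log_deriv_1 neg_log_deriv_mult)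

lemma neg_log_deriv_power:
  assumes "neg_log_deriv f L"
  shows "neg_log_deriv (f ^ n) (of_nat n * L)"
  using neg_log_deriv_prod[of "{..<n}" "\<lambda>_. f" "\<lambda>_. L"] assms by simp

lemma neg_log_deriv_inverse:
  fixes f :: "'a::field fps"
  assumes "neg_log_deriv f L" "fps_nth f 0 \<noteq> 0"
  shows "neg_log_deriv (inverse f) (- L)"
proof -
  have "- (fps_X * fps_deriv (inverse f)) = - (inverse f)\<^sup>2 * (- (fps_X * fps_deriv f))"
    by (simp add: fps_inverse_deriv[OF assms(2)] algebra_simps)
  also have "\<dots> = - (inverse f)\<^sup>2 * (f * L)"
    using assms(1) by (simp only: neg_log_deriv_def)
  also have "\<dots> = (inverse f * f) * (inverse f * - L)"
    by (simp add: power2_eq_square algebra_simps)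
  also have "inverse f * f = 1"
    by (rule inverse_mult_eq_1) fact
  finally show ?thesis
    by (simp add: neg_log_deriv_def)
qed

lemma neg_log_deriv_power_int:
  fixes f :: "'a::field fps"
  assumes "neg_log_deriv f L" "fps_nth f 0 \<noteq> 0"
  shows "neg_log_deriv (f powi k) (of_int k * L)"
proof (cases "k \<ge> 0")
  case True
  then show ?thesis
    using neg_log_deriv_power[OF assms(1), of "nat k"] by (simp add: power_int_def)
next
  case False
  then show ?thesis
    using neg_log_deriv_power[OF neg_log_deriv_inverse[OF assms], of "nat (- k)"]
    by (simp add: power_int_def)
qed

text \<open>
  In the \<open>X\<close>-adic topology each coefficient of a convergent sequence is eventually constant, and the
  defining identity involves only finitely many coefficients at a time.
\<close>

lemma neg_log_deriv_tendsto:
  assumes lim: "P \<longlonglongrightarrow> f" "Q \<longlonglongrightarrow> L" and P: "\<And>N. neg_log_deriv (P N) (Q N)"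
  shows "neg_log_deriv f L"
  unfolding neg_log_deriv_def
proof (rule fps_ext)
  fix n
  have "\<forall>\<^sub>F N in sequentially. \<forall>i\<in>{..n}. fps_nth (P N) i = fps_nth f i \<and> fps_nth (Q N) i = fps_nth L i"
    using lim by (intro eventually_ball_finite ballI eventually_conj) (auto simp: tendsto_fps_iff)
  then obtain N where N: "\<And>i. i \<le> n \<Longrightarrow> fps_nth (P N) i = fps_nth f i"
      "\<And>i. i \<le> n \<Longrightarrow> fps_nth (Q N) i = fps_nth L i"
    by (auto simp: eventually_sequentially)
  have "fps_nth (- (fps_X * fps_deriv f)) n = fps_nth (- (fps_X * fps_deriv (P N))) n"
    unfolding neg_theta_nth using N(1)[of n] by simp
  also have "\<dots> = fps_nth (P N * Q N) n"
    using P by (simp add: neg_log_deriv_def)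
  also have "\<dots> = fps_nth (f * L) n"
    by (simp add: fps_mult_nth N)
  finally show "fps_nth (- (fps_X * fps_deriv f)) n = fps_nth (f * L) n" .
qed

text \<open>The expansion of \<open>r X^r / (1 - X^r)\<close>.\<close>

definition multiples_fps :: "nat \<Rightarrow> 'a::comm_ring_1 fps" where
  "multiples_fps r = Abs_fps (\<lambda>n. if 0 < n \<and> r dvd n then of_nat r else 0)"

lemma neg_log_deriv_one_minus_X_power:
  assumes "r > 0"
  shows "neg_log_deriv (1 - fps_X ^ r) (multiples_fps r)"
proof -
  have "(1 - fps_X ^ r) * (multiples_fps r :: 'a fps) = of_nat r * fps_X ^ r"
  proof (rule fps_ext)
    fix n
    consider "n < r" | "n = r" | "n > r" by linarith
    then show "fps_nth ((1 - fps_X ^ r) * multiples_fps r) n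
        = fps_nth (of_nat r * fps_X ^ r :: 'a fps) n"
    proof cases
      case 1
      then show ?thesis
        by (auto simp: algebra_simps fps_X_power_mult_nth multiples_fps_def fps_of_nat [symmetric]
              dest: dvd_imp_le)
    next
      case 2
      then show ?thesis using assms
        by (auto simp: algebra_simps fps_X_power_mult_nth multiples_fps_def fps_of_nat [symmetric])
    next
      case 3
      then have "r dvd n - r \<longleftrightarrow> r dvd n"
        by (metis dvd_diff_nat dvd_refl dvd_diffD less_imp_le_nat)
      with 3 show ?thesis
        by (auto simp: algebra_simps fps_X_power_mult_nth multiples_fps_def fps_of_nat [symmetric])
    qed
  qed
  moreover have "- (fps_X * fps_deriv (1 - fps_X ^ r)) = (of_nat r * fps_X ^ r :: 'a fps)"
  proof -
    have "fps_deriv (fps_X ^ r :: 'a fps) = of_nat r * fps_X ^ (r - 1)"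
      by (simp only: fps_deriv_power' fps_deriv_fps_X mult_1_right)
    then have "- (fps_X * fps_deriv (1 - fps_X ^ r)) = of_nat r * (fps_X * fps_X ^ (r - 1) :: 'a fps)"
      by (simp only: fps_deriv_sub fps_deriv_1 diff_0 mult_minus_right minus_minus mult.left_commute)
    also have "fps_X * fps_X ^ (r - 1) = (fps_X ^ r :: 'a fps)"
      using assms by (metis power_eq_if not_gr_zero)
    finally show ?thesis .
  qed
  ultimately show ?thesis
    by (simp add: neg_log_deriv_def)
qed

lemma neg_log_deriv_unique:
  fixes f :: "'a::idom fps"
  assumes "neg_log_deriv f L" "neg_log_deriv f M" "f \<noteq> 0"
  shows "L = M"
  using assms by (simp add: neg_log_deriv_def)

text \<open>
  This is \<open>-X / (X - q) = (X/q) / (1 - X/q)\<close>, a geometric series without its constant term: a simple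
  zero at \<open>q\<close> contributes exactly \<open>q^(-n)\<close> to the \<open>n\<close>-th coefficient.
\<close>

lemma neg_log_deriv_linear_factor:
  fixes q :: "'a::field"
  assumes "q \<noteq> 0"
  shows "neg_log_deriv (fps_X - fps_const q) (Abs_fps (\<lambda>n. if n = 0 then 0 else 1 / q ^ n))"
  unfolding neg_log_deriv_def
proof (rule fps_ext)
  fix n
  show "fps_nth (- (fps_X * fps_deriv (fps_X - fps_const q))) n
      = fps_nth ((fps_X - fps_const q) * Abs_fps (\<lambda>n. if n = 0 then 0 else 1 / q ^ n)) n"
    using assms by (cases n) (auto simp: left_diff_distrib field_simps)
qed

section \<open>Weighted divisor sums\<close>

text \<open>
  For \<open>n > 0\<close> the index set consists of all divisors of \<open>n\<close>. At \<open>n = 0\<close> it is empty, so the value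
  agrees with the constant coefficient \<open>0\<close> of a logarithmic derivative.
\<close>

definition weighted_divisor_sum :: "(nat \<Rightarrow> int) \<Rightarrow> nat \<Rightarrow> int" where
  "weighted_divisor_sum \<kappa> n = (\<Sum>d | d \<in> {1..n} \<and> d dvd n. int d * \<kappa> d)"

lemma weighted_divisor_sum_0 [simp]: "weighted_divisor_sum \<kappa> 0 = 0"
  by (simp add: weighted_divisor_sum_def)

text \<open>A proper divisor of \<open>n\<close> is at most \<open>n div 2\<close>.\<close>

lemma weighted_divisor_sum_split:
  assumes "n > 0"
  shows "weighted_divisor_sum \<kappa> n
    = int n * \<kappa> n + (\<Sum>d | d \<in> {1..n div 2} \<and> d dvd n. int d * \<kappa> d)"
proof -
  have *: "{d. d \<in> {1..n} \<and> d dvd n} = insert n {d. d \<in> {1..n div 2} \<and> d dvd n}" (is "?A = ?B")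
  proof
    show "?A \<subseteq> ?B"
    proof
      fix d assume d: "d \<in> ?A"
      then obtain k where k: "n = d * k" by auto
      show "d \<in> ?B"
      proof (cases "k \<le> 1")
        case True
        with k assms have "k = 1" by (cases k) auto
        with k show ?thesis by auto
      next
        case False
        then have "d * 2 \<le> n"
          unfolding k by (intro mult_le_mono) auto
        with d show ?thesis by auto
      qed
    qed
    show "?B \<subseteq> ?A"
      using assms by auto
  qed
  show ?thesis
    unfolding weighted_divisor_sum_def * using assms by (subst sum.insert) auto
qed

lemma weighted_divisor_sum_cancel:
  assumes "weighted_divisor_sum \<kappa> = weighted_divisor_sum \<kappa>'" "r > 0"
  shows "\<kappa> r = \<kappa>' r"
  using assms(2)
proof (induction r rule: less_induct)
  case (less r)
  have "(\<Sum>d | d \<in> {1..r div 2} \<and> d dvd r. int d * \<kappa> d)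
      = (\<Sum>d | d \<in> {1..r div 2} \<and> d dvd r. int d * \<kappa>' d)"
    using less by (intro sum.cong) auto
  with fun_cong[OF assms(1), of r] show ?case
    using less.prems by (simp add: weighted_divisor_sum_split)
qed

section \<open>The coefficients of \<open>D\<close>\<close>

definition D_coeff :: "nat \<Rightarrow> int" where
  "D_coeff n = fps_nth D_fps n"

lemma strict_mono_triangle: "strict_mono triangle"
  by (rule strict_mono_Suc_iff[THEN iffD2]) simp

lemma D_fps_nth: "fps_nth (D_fps :: 'a::comm_ring_1 fps) n = of_int (D_coeff n)"
  by (simp add: D_fps_def D_coeff_def)

lemma D_coeff_triangle: "D_coeff (triangle k) = (-1) ^ triangle k * (2 * int k + 1)"
proof -
  have "{j. triangle j = triangle k} = {k}"
    using strict_mono_eq[OF strict_mono_triangle] by auto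
  then show ?thesis
    by (simp add: D_coeff_def D_fps_def)
qed

lemma D_coeff_gap:
  assumes "triangle k < n" "n < triangle (Suc k)"
  shows "D_coeff n = 0"
proof -
  have "{j. triangle j = n} = {}"
  proof safe
    fix j assume "n = triangle j"
    with assms have "k < j" "j < Suc k"
      using strict_mono_less[OF strict_mono_triangle] by blast+
    then show "j \<in> {}" by simp
  qed
  then show ?thesis
    by (simp add: D_coeff_def D_fps_def)
qed

lemma D_coeff_values:
  "D_coeff 0 = 1" "D_coeff (Suc 0) = -3" "D_coeff 2 = 0" "D_coeff 3 = -5"
  "D_coeff 4 = 0" "D_coeff 5 = 0" "D_coeff 6 = 7" "D_coeff 7 = 0" "D_coeff 8 = 0"
  "D_coeff 9 = 0" "D_coeff 10 = 9" "D_coeff 11 = 0" "D_coeff 12 = 0" "D_coeff 13 = 0"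
  "D_coeff 14 = 0"
  using D_coeff_triangle[of 0] D_coeff_triangle[of 1] D_coeff_triangle[of 2]
    D_coeff_triangle[of 3] D_coeff_triangle[of 4]
    D_coeff_gap[of 1] D_coeff_gap[of 2] D_coeff_gap[of 3] D_coeff_gap[of 4]
  by (simp_all add: triangle_def)

text \<open>
  The worst cases are \<open>k = 1\<close> and \<open>k = 2\<close>, where \<open>2 k + 1 = triangle k + 2\<close>; for larger \<open>k\<close> the
  triangular number grows faster than \<open>2 k + 1\<close>.
\<close>

lemma abs_D_coeff_le: "\<bar>D_coeff n\<bar> \<le> int n + 2"
proof (cases "\<exists>k. n = triangle k")
  case True
  then obtain k where k: "n = triangle k" by blast
  have "2 * k + 1 \<le> triangle k + 2"
  proof (induction k)
    case (Suc k)
    then show ?case by (cases k) auto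
  qed simp
  then show ?thesis
    by (simp add: k D_coeff_triangle abs_mult power_abs)
next
  case False
  then have "{k. triangle k = n} = {}"
    by auto
  then have "D_coeff n = 0"
    by (simp add: D_coeff_def D_fps_def)
  then show ?thesis by simp
qed

lemma D_fps_nth_0 [simp]: "fps_nth D_fps 0 = 1"
  by (simp add: D_fps_nth D_coeff_values)

lemma D_fps_nonzero: "(D_fps :: 'a::comm_ring_1 fps) \<noteq> 0"
  using D_fps_nth_0 [where 'a = 'a] by (metis fps_zero_nth zero_neq_one)

section \<open>Uniqueness of the exponents\<close>

lemma fps_power_int_nth_0:
  fixes f :: "'a::field fps"
  assumes "fps_nth f 0 = 1"
  shows "fps_nth (f powi k) 0 = 1"
  using assms by (simp add: power_int_def fps_nth_power_0)

lemma has_prod_fps_iff: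
  fixes f :: "nat \<Rightarrow> 'a::field fps"
  assumes "\<And>i. fps_nth (f i) 0 = 1" "F \<noteq> 0"
  shows "f has_prod F \<longleftrightarrow> (\<lambda>n. \<Prod>i\<le>n. f i) \<longlonglongrightarrow> F"
  using assms by (simp add: has_prod_def raw_has_prod_def)

abbreviation factor :: "(nat \<Rightarrow> int) \<Rightarrow> nat \<Rightarrow> complex fps" where
  "factor \<kappa> r \<equiv> (1 - fps_X ^ Suc r) powi \<kappa> (Suc r)"

lemma product_exponents_iff:
  "product_exponents \<kappa> \<longleftrightarrow> (\<lambda>n. \<Prod>i\<le>n. factor \<kappa> i) \<longlonglongrightarrow> D_fps"
  unfolding product_exponents_def
  by (intro has_prod_fps_iff fps_power_int_nth_0) (auto simp: D_fps_nonzero)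

definition divisor_sum_fps :: "(nat \<Rightarrow> int) \<Rightarrow> 'a::comm_ring_1 fps" where
  "divisor_sum_fps \<kappa> = Abs_fps (\<lambda>n. of_int (weighted_divisor_sum \<kappa> n))"

lemma sum_multiples_fps_tendsto:
  "(\<lambda>N. \<Sum>i\<le>N. of_int (\<kappa> (Suc i)) * multiples_fps (Suc i))
     \<longlonglongrightarrow> (divisor_sum_fps \<kappa> :: 'a::comm_ring_1 fps)"
proof (rule tendsto_fpsI)
  fix n
  have "fps_nth (\<Sum>i\<le>N. of_int (\<kappa> (Suc i)) * multiples_fps (Suc i)) n
      = fps_nth (divisor_sum_fps \<kappa> :: 'a fps) n" if "N \<ge> n" for N
  proof (cases "n = 0")
    case True
    then show ?thesis
      by (simp add: fps_sum_nth divisor_sum_fps_def fps_of_int [symmetric] multiples_fps_def)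
  next
    case False
    have "fps_nth (\<Sum>i\<le>N. of_int (\<kappa> (Suc i)) * multiples_fps (Suc i)) n
        = (\<Sum>i\<le>N. if Suc i dvd n then of_int (int (Suc i) * \<kappa> (Suc i)) else (0::'a))"
      unfolding fps_sum_nth using False
      by (intro sum.cong refl) (simp add: fps_of_int [symmetric] multiples_fps_def algebra_simps)
    also have "\<dots> = (\<Sum>d\<in>{1..Suc N}. if d dvd n then of_int (int d * \<kappa> d) else (0::'a))"
      by (rule sum.reindex_bij_witness[of _ "\<lambda>d. d - 1" Suc]) auto
    also have "\<dots> = (\<Sum>d | d \<in> {1..n} \<and> d dvd n. of_int (int d * \<kappa> d))"
      using False that by (intro sum.mono_neutral_cong_right) (auto dest: dvd_imp_le)
    finally show ?thesis
      by (simp add: divisor_sum_fps_def weighted_divisor_sum_def)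
  qed
  then show "\<forall>\<^sub>F N in sequentially.
      fps_nth (\<Sum>i\<le>N. of_int (\<kappa> (Suc i)) * multiples_fps (Suc i)) n
      = fps_nth (divisor_sum_fps \<kappa> :: 'a fps) n"
    unfolding eventually_sequentially by blast
qed

text \<open>
  The logarithmic derivative turns the product into a sum of Lambert series
  \<open>\<Sum>r \<kappa>(r) r X^r / (1 - X^r)\<close>, whose coefficients are the weighted divisor sums.
\<close>

lemma neg_log_deriv_D:
  assumes "product_exponents \<kappa>"
  shows "neg_log_deriv D_fps (divisor_sum_fps \<kappa> :: complex fps)"
proof (rule neg_log_deriv_tendsto)
  show "(\<lambda>n. \<Prod>i\<le>n. factor \<kappa> i) \<longlonglongrightarrow> D_fps"
    using assms by (simp add: product_exponents_iff)
  show "neg_log_deriv (\<Prod>i\<le>n. factor \<kappa> i) (\<Sum>i\<le>n. of_int (\<kappa> (Suc i)) * multiples_fps (Suc i))" for n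
    by (intro neg_log_deriv_prod neg_log_deriv_power_int neg_log_deriv_one_minus_X_power) auto
qed (rule sum_multiples_fps_tendsto)

lemma product_exponents_unique:
  assumes "product_exponents \<kappa>" "product_exponents \<kappa>'" "r > 0"
  shows "\<kappa> r = \<kappa>' r"
proof (rule weighted_divisor_sum_cancel)
  have "divisor_sum_fps \<kappa> = (divisor_sum_fps \<kappa>' :: complex fps)"
    using neg_log_deriv_D[OF assms(1)] neg_log_deriv_D[OF assms(2)] D_fps_nonzero
    by (rule neg_log_deriv_unique)
  then show "weighted_divisor_sum \<kappa> = weighted_divisor_sum \<kappa>'"
    by (auto simp: divisor_sum_fps_def fps_eq_iff)
qed fact

text \<open>
  Newton's identity for power sums, with \<open>a(n)\<close> in the role of the sum of the \<open>n\<close>-th powers of the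
  inverse zeros of \<open>D\<close>: compare coefficients in \<open>-X D' = D \<cdot> \<Sum>n a(n) X^n\<close>.
\<close>

lemma divisor_sum_recurrence:
  assumes "product_exponents \<kappa>"
  shows "(\<Sum>i\<le>n. D_coeff i * weighted_divisor_sum \<kappa> (n - i)) = - int n * D_coeff n"
proof -
  have "fps_nth (- (fps_X * fps_deriv D_fps)) n = fps_nth (D_fps * divisor_sum_fps \<kappa> :: complex fps) n"
    using neg_log_deriv_D[OF assms] by (simp add: neg_log_deriv_def)
  then have "(of_int (- int n * D_coeff n) :: complex)
      = of_int (\<Sum>i\<le>n. D_coeff i * weighted_divisor_sum \<kappa> (n - i))"
    unfolding neg_theta_nth by (simp add: fps_mult_nth D_fps_nth divisor_sum_fps_def atLeast0AtMost)
  then show ?thesis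
    unfolding of_int_eq_iff by simp
qed

section \<open>Existence of the exponents\<close>

definition int_coeffs :: "'a::ring_1 fps \<Rightarrow> bool" where
  "int_coeffs f \<longleftrightarrow> (\<forall>n. fps_nth f n \<in> \<int>)"

lemma int_coeffs_mult: "int_coeffs f \<Longrightarrow> int_coeffs g \<Longrightarrow> int_coeffs (f * g)"
  by (auto simp: int_coeffs_def fps_mult_nth intro!: Ints_sum Ints_mult)

lemma int_coeffs_power: "int_coeffs f \<Longrightarrow> int_coeffs (f ^ n)"
proof (induction n)
  case 0
  then show ?case by (auto simp: int_coeffs_def)
qed (auto intro: int_coeffs_mult)

lemma inverse_one_minus_X_power:
  assumes "r > 0"
  shows "inverse (1 - fps_X ^ r) = Abs_fps (\<lambda>n. if r dvd n then 1 else (0::'a::field))" (is "_ = ?g")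
proof (rule fps_inverse_unique)
  show "(1 - fps_X ^ r) * ?g = 1"
  proof (rule fps_ext)
    fix n
    have "r dvd n - r \<longleftrightarrow> r dvd n" if "r \<le> n"
      using that by (metis dvd_diff_nat dvd_refl dvd_diffD)
    moreover have "\<not> r dvd n" if "n < r" "n > 0"
      using that by (auto dest: dvd_imp_le)
    ultimately show "fps_nth ((1 - fps_X ^ r) * ?g) n = fps_nth 1 n"
      using assms by (cases "n < r") (auto simp: left_diff_distrib fps_X_power_mult_nth)
  qed
qed

lemma int_coeffs_one_minus_X_power: "int_coeffs (1 - fps_X ^ r)"
  by (auto simp: int_coeffs_def)

lemma int_coeffs_factor:
  assumes "r > 0"
  shows "int_coeffs ((1 - fps_X ^ r) powi k :: 'a::field fps)"
proof (cases "k \<ge> 0")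
  case True
  then show ?thesis
    unfolding power_int_def by (auto intro!: int_coeffs_power int_coeffs_one_minus_X_power)
next
  case False
  have "int_coeffs (inverse (1 - fps_X ^ r) :: 'a fps)"
    unfolding inverse_one_minus_X_power[OF assms] by (auto simp: int_coeffs_def)
  with False show ?thesis
    unfolding power_int_def by (auto intro!: int_coeffs_power)
qed

text \<open>
  \<open>(1 - X^r)^k = 1 - k X^r + O(X^(r+1))\<close> for every integer \<open>k\<close>. The logarithmic derivative gives it
  without separating the signs of \<open>k\<close>: \<open>-n f(n) = \<Sum>i f(i) k m(n-i)\<close>, where the coefficients
  \<open>m\<close> of \<open>multiples_fps r\<close> vanish below \<open>r\<close>, so that only \<open>i = 0\<close> survives for \<open>n \<le> r\<close>.
\<close>

lemma factor_nth:
  assumes "n > 0" "n \<le> r"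
  shows "fps_nth ((1 - fps_X ^ r) powi k :: complex fps) n = (if n = r then - of_int k else 0)"
proof -
  have r: "r > 0" using assms by simp
  let ?f = "(1 - fps_X ^ r) powi k :: complex fps"
  have "neg_log_deriv ?f (of_int k * multiples_fps r)"
    using r by (intro neg_log_deriv_power_int neg_log_deriv_one_minus_X_power) auto
  then have "fps_nth (- (fps_X * fps_deriv ?f)) n = fps_nth (?f * (of_int k * multiples_fps r)) n"
    by (simp add: neg_log_deriv_def)
  moreover have "fps_nth (- (fps_X * fps_deriv ?f)) n = - of_nat n * fps_nth ?f n"
    by (rule neg_theta_nth)
  moreover have "fps_nth (?f * (of_int k * multiples_fps r)) n
      = (\<Sum>i\<in>{0}. fps_nth ?f i * fps_nth (of_int k * multiples_fps r) (n - i))"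
    unfolding fps_mult_nth[of ?f] using assms
    by (intro sum.mono_neutral_right)
       (auto simp: fps_of_int [symmetric] multiples_fps_def dest!: dvd_imp_le)
  moreover have "fps_nth ?f 0 = 1"
    using r by (intro fps_power_int_nth_0) simp
  ultimately have "- of_nat n * fps_nth ?f n = (if n = r then of_int k * of_nat r else 0)"
    using assms by (auto simp: fps_of_int [symmetric] multiples_fps_def dest!: dvd_imp_le)
  also have "\<dots> = - of_nat n * (if n = r then - of_int k else 0)"
    by simp
  finally show ?thesis
    using assms by (subst (asm) mult_cancel_left) simp
qed

text \<open>
  Greedy construction: the new factor corrects the coefficient of \<open>X^(Suc n)\<close>. The difference of
  coefficients to be cancelled is an integer by \<open>partial_product_int_coeffs\<close>, so \<open>\<lfloor>Re _\<rfloor>\<close> merely converts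
  it from \<open>complex\<close> to \<open>int\<close>.
\<close>

primrec partial_product :: "nat \<Rightarrow> complex fps" where
  "partial_product 0 = 1"
| "partial_product (Suc n) = partial_product n *
     (1 - fps_X ^ Suc n) powi \<lfloor>Re (fps_nth (partial_product n - D_fps) (Suc n))\<rfloor>"

lemma partial_product_int_coeffs: "int_coeffs (partial_product n)"
proof (induction n)
  case 0
  then show ?case by (auto simp: int_coeffs_def)
next
  case (Suc n)
  then show ?case
    unfolding partial_product.simps by (intro int_coeffs_mult int_coeffs_factor) auto
qed

lemma partial_product_agrees:
  "i \<le> n \<Longrightarrow> fps_nth (partial_product n) i = fps_nth D_fps i"
proof (induction n arbitrary: i)
  case 0
  then show ?case by simp
next
  case (Suc n)
  define P where "P = partial_product n"
  define k where "k = \<lfloor>Re (fps_nth (P - D_fps) (Suc n))\<rfloor>"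
  define F :: "complex fps" where "F = (1 - fps_X ^ Suc n) powi k"
  have P0: "fps_nth P 0 = 1"
    unfolding P_def using Suc.IH[of 0] by simp
  have F0: "fps_nth F 0 = 1"
    unfolding F_def by (intro fps_power_int_nth_0) simp
  have "fps_nth (P - D_fps) (Suc n) \<in> \<int>"
    using partial_product_int_coeffs[of n] by (simp add: P_def int_coeffs_def D_fps_nth)
  then obtain z where "fps_nth (P - D_fps) (Suc n) = of_int z"
    by (elim Ints_cases)
  then have k: "of_int k = fps_nth (P - D_fps) (Suc n)"
    by (simp only: k_def Re_complex_of_real complex_Re_of_int floor_of_int)
  have F: "fps_nth F j = (if j = Suc n then - of_int k else 0)" if "0 < j" "j \<le> Suc n" for j
    unfolding F_def using that by (rule factor_nth)
  have "fps_nth (P * F) i = (\<Sum>j=0..i. fps_nth P (i - j) * fps_nth F j)"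
    unfolding mult.commute[of P F] fps_mult_nth by (simp add: mult.commute)
  also have "\<dots> = fps_nth P i + (\<Sum>j=Suc 0..i. fps_nth P (i - j) * fps_nth F j)"
    by (simp add: sum.atLeast_Suc_atMost F0)
  also have "(\<Sum>j=Suc 0..i. fps_nth P (i - j) * fps_nth F j)
      = (\<Sum>j=Suc 0..i. if j = Suc n then - of_int k * fps_nth P (i - Suc n) else 0)"
    using Suc.prems by (intro sum.cong) (auto simp: F)
  also have "\<dots> = (if i = Suc n then - of_int k else 0)"
    using Suc.prems P0 by (simp add: sum.delta)
  finally have "fps_nth (P * F) i = fps_nth D_fps i"
    using Suc k by (auto simp: P_def le_Suc_eq)
  then show ?case
    by (simp add: P_def F_def k_def)
qed

lemma product_exponents_exist: "\<exists>\<kappa>. \<kappa> 0 = 0 \<and> product_exponents \<kappa>"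
proof -
  define \<kappa> where "\<kappa> n = (case n of 0 \<Rightarrow> 0 | Suc m \<Rightarrow>
    \<lfloor>Re (fps_nth (partial_product m - D_fps) (Suc m))\<rfloor>)" for n
  have "(\<Prod>i\<le>n. factor \<kappa> i) = partial_product (Suc n)" for n
    by (induction n) (simp_all add: \<kappa>_def mult.commute)
  moreover have "(\<lambda>n. partial_product (Suc n)) \<longlonglongrightarrow> D_fps"
  proof (rule tendsto_fpsI)
    show "\<forall>\<^sub>F n in sequentially. fps_nth (partial_product (Suc n)) i = fps_nth D_fps i" for i
      unfolding eventually_sequentially
      by (intro exI[of _ i] allI impI partial_product_agrees) simp
  qed
  ultimately have "product_exponents \<kappa>"
    by (simp add: product_exponents_iff)
  moreover have "\<kappa> 0 = 0"
    by (simp add: \<kappa>_def)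
  ultimately show ?thesis by blast
qed

lemma product_exponents_ex1: "\<exists>!\<kappa>. \<kappa> 0 = 0 \<and> product_exponents \<kappa>"
proof -
  have "\<kappa> = \<kappa>'" if "\<kappa> 0 = 0" "product_exponents \<kappa>" "\<kappa>' 0 = 0" "product_exponents \<kappa>'" for \<kappa> \<kappa>'
  proof
    fix r show "\<kappa> r = \<kappa>' r"
      using that product_exponents_unique[of \<kappa> \<kappa>' r] by (cases "r = 0") auto
  qed
  then show ?thesis
    using product_exponents_exist by blast
qed

lemma product_exponents_kappa: "product_exponents kappa"
  using theI'[OF product_exponents_ex1] unfolding kappa_def by blast

section \<open>Growth of the divisor sums and positivity of the exponents\<close>

lemma sum_atMost_6:
  fixes f :: "nat \<Rightarrow> 'a::comm_ring_1"
  assumes "n \<ge> 6"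
  shows "(\<Sum>i\<le>n. f i) = f 0 + f 1 + f 2 + f 3 + f 4 + f 5 + (\<Sum>i\<in>{6..n}. f i)"
proof -
  have "{..n} = {..5} \<union> {6..n}" using assms by auto
  then have "(\<Sum>i\<le>n. f i) = (\<Sum>i\<le>5. f i) + (\<Sum>i\<in>{6..n}. f i)"
    by (simp add: sum.union_disjoint)
  then show ?thesis
    by (simp add: atMost_nat_numeral algebra_simps)
qed

lemma divisor_sum_values:
  assumes "product_exponents \<kappa>"
  shows "weighted_divisor_sum \<kappa> (Suc 0) = 3" "weighted_divisor_sum \<kappa> 2 = 9"
    "weighted_divisor_sum \<kappa> 3 = 42" "weighted_divisor_sum \<kappa> 4 = 141"
    "weighted_divisor_sum \<kappa> 5 = 468" "weighted_divisor_sum \<kappa> 6 = 1572"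
    "weighted_divisor_sum \<kappa> 7 = 5400" "weighted_divisor_sum \<kappa> 8 = 18477"
proof -
  note rec = divisor_sum_recurrence[OF assms]
  show a1: "weighted_divisor_sum \<kappa> (Suc 0) = 3"
    using rec[of 1] by (simp add: D_coeff_values)
  show a2: "weighted_divisor_sum \<kappa> 2 = 9"
    using rec[of 2] by (simp add: atMost_nat_numeral D_coeff_values a1)
  show a3: "weighted_divisor_sum \<kappa> 3 = 42"
    using rec[of 3] by (simp add: atMost_nat_numeral D_coeff_values a1 a2)
  show a4: "weighted_divisor_sum \<kappa> 4 = 141"
    using rec[of 4] by (simp add: atMost_nat_numeral D_coeff_values a1 a2 a3)
  show a5: "weighted_divisor_sum \<kappa> 5 = 468"
    using rec[of 5] by (simp add: atMost_nat_numeral D_coeff_values a1 a2 a3 a4)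
  show a6: "weighted_divisor_sum \<kappa> 6 = 1572"
    using rec[of 6] by (simp add: atMost_nat_numeral D_coeff_values a1 a2 a3 a4 a5)
  show a7: "weighted_divisor_sum \<kappa> 7 = 5400"
    using rec[of 7] by (simp add: atMost_nat_numeral D_coeff_values a1 a2 a3 a4 a5 a6)
  show "weighted_divisor_sum \<kappa> 8 = 18477"
    using rec[of 8] by (simp add: atMost_nat_numeral D_coeff_values a1 a2 a3 a4 a5 a6 a7)
qed

lemma two_thirds_power_sum_le:
  assumes "n \<ge> 5"
  shows "(\<Sum>i\<in>{6..n}. (2 / 3 :: real) ^ (i - 3)) \<le> 8 / 9"
proof -
  have "(\<Sum>i\<in>{6..n}. (2 / 3 :: real) ^ (i - 3)) = 8 / 9 - 3 * (2 / 3) ^ (n - 2)"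
    using assms
  proof (induction n rule: dec_induct)
    case base
    then show ?case by (simp add: power_divide)
  next
    case (step n)
    then have "Suc n - 2 = Suc (n - 2)" "Suc n - 3 = n - 2" by auto
    with step show ?case by (simp add: algebra_simps)
  qed
  then show ?thesis by simp
qed

text \<open>
  The next two bounds compare the coefficients with powers of \<open>2\<close> and \<open>3\<close> from index \<open>6\<close> on, the
  first index after \<open>3\<close> at which \<open>D\<close> has a nonzero coefficient.
\<close>

lemma add_2_le_power:
  assumes "n \<ge> 6"
  shows "n + 2 \<le> 2 ^ (n - 3)"
  using assms
proof (induction n rule: dec_induct)
  case (step n)
  then have "Suc n - 3 = Suc (n - 3)" by auto
  with step show ?case by simp
qed simp

lemma mult_add_2_le_power:
  assumes "n \<ge> 6"
  shows "n * (n + 2) \<le> 2 * 3 ^ (n - 3)"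
  using assms
proof (induction n rule: dec_induct)
  case (step n)
  then have "Suc n - 3 = Suc (n - 3)" by auto
  moreover have "Suc n * (Suc n + 2) \<le> 3 * (n * (n + 2))"
  proof -
    have "6 * n \<le> n * n" using step by (intro mult_le_mono) auto
    then show ?thesis using step by (simp add: algebra_simps)
  qed
  ultimately show ?case using step by simp
qed simp

text \<open>
  Write \<open>c(i)\<close> for the coefficients of \<open>D\<close>. For \<open>n \<ge> 6\<close> the recurrence reads
  \<open>a(n) = 3 a(n-1) + 5 a(n-3) - \<Sum>i\<ge>6. c(i) a(n-i) - n c(n)\<close>. By induction \<open>a\<close> has at least tripled
  at each earlier step, so \<open>|c(i)| \<le> 2^(i-3)\<close> bounds the sum by
  \<open>a(n-3) \<Sum>i\<ge>6. (2/3)^(i-3) = (8/9) a(n-3)\<close>, while \<open>n |c(n)| \<le> 2 \<cdot> 3^(n-3) \<le> 2 a(n-3)\<close>. Together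
  these stay below \<open>5 a(n-3)\<close>. The second conjunct serves the induction: it provides the lower
  bound \<open>3^(n-3) \<le> a(n-3)\<close>.
\<close>

lemma divisor_sum_growth:
  assumes "product_exponents \<kappa>" "n > 0"
  shows "3 * weighted_divisor_sum \<kappa> (n - 1) \<le> weighted_divisor_sum \<kappa> n
    \<and> 3 ^ n \<le> weighted_divisor_sum \<kappa> n"
  using assms(2)
proof (induction n rule: less_induct)
  case (less n)
  define a where "a = weighted_divisor_sum \<kappa>"
  have IH: "3 * a (m - 1) \<le> a m" "3 ^ m \<le> a m" if "0 < m" "m < n" for m
    using less.IH[of m] that by (auto simp: a_def)
  show ?case
  proof (cases "n \<ge> 6")
    case False
    with less.prems have "n \<in> {1, 2, 3, 4, 5}" by auto
    then show ?thesis
      using divisor_sum_values[OF assms(1)] by auto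
  next
    case n: True
    have mono: "3 ^ (m - j) * a j \<le> a m" if "j \<le> m" "m < n" for j m
      using that
    proof (induction m rule: dec_induct)
      case (step m)
      then have "3 ^ (Suc m - j) * a j = 3 * (3 ^ (m - j) * a j)"
        by (simp add: Suc_diff_le)
      also have "\<dots> \<le> 3 * a m" using step by simp
      also have "\<dots> \<le> a (Suc m)" using IH(1)[of "Suc m"] step by simp
      finally show ?case .
    qed simp
    have nonneg: "0 \<le> a m" if "m < n" for m
    proof (cases "m = 0")
      case False
      with that have "(3::int) ^ m \<le> a m" by (intro IH(2)) auto
      then show ?thesis using zero_le_power[of "3::int" m] by linarith
    qed (simp add: a_def)
    define A where "A = real_of_int (a (n - 3))"
    have A0: "0 \<le> A"
      using nonneg[of "n - 3"] n by (simp add: A_def)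
    have summand: "\<bar>real_of_int (D_coeff i * a (n - i))\<bar> \<le> (2 / 3) ^ (i - 3) * A" if i: "i \<in> {6..n}" for i
    proof -
      have "3 ^ (i - 3) * a (n - i) \<le> a (n - 3)"
        using mono[of "n - i" "n - 3"] i n by (simp add: diff_le_mono2)
      then have "real_of_int (3 ^ (i - 3) * a (n - i)) \<le> A"
        unfolding A_def of_int_le_iff .
      then have 1: "real_of_int (a (n - i)) \<le> A / 3 ^ (i - 3)"
        by (simp add: field_simps)
      have "\<bar>D_coeff i\<bar> \<le> int (2 ^ (i - 3))"
        using abs_D_coeff_le[of i] add_2_le_power[of i] i by (auto simp del: of_nat_power)
      then have 2: "\<bar>real_of_int (D_coeff i)\<bar> \<le> 2 ^ (i - 3)"
        by (metis of_int_abs of_int_le_iff of_int_of_nat_eq of_nat_numeral of_nat_power)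
      have "\<bar>real_of_int (D_coeff i)\<bar> * real_of_int (a (n - i)) \<le> 2 ^ (i - 3) * (A / 3 ^ (i - 3))"
        using nonneg[of "n - i"] i n by (intro mult_mono 1 2) auto
      then show ?thesis
        using nonneg[of "n - i"] i n by (simp add: abs_mult power_divide)
    qed
    have "\<bar>\<Sum>i\<in>{6..n}. real_of_int (D_coeff i * a (n - i))\<bar> \<le> (\<Sum>i\<in>{6..n}. (2 / 3) ^ (i - 3) * A)"
      by (intro order_trans[OF sum_abs] sum_mono summand)
    also have "\<dots> \<le> 8 / 9 * A"
      unfolding sum_distrib_right[symmetric]
      using two_thirds_power_sum_le[of n] n A0 by (intro mult_right_mono) auto
    also have "\<dots> \<le> A" using A0 by simp
    finally have "\<bar>\<Sum>i\<in>{6..n}. D_coeff i * a (n - i)\<bar> \<le> a (n - 3)"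
      unfolding A_def of_int_sum[symmetric] of_int_abs[symmetric] of_int_le_iff .
    moreover have "int n * D_coeff n \<le> 2 * a (n - 3)"
    proof -
      have "int n * D_coeff n \<le> int (n * (n + 2))"
        using abs_D_coeff_le[of n] mult_left_mono[of "D_coeff n" "int n + 2" "int n"]
        by (simp add: algebra_simps)
      also have "\<dots> \<le> int (2 * 3 ^ (n - 3))"
        using mult_add_2_le_power[OF n] by (simp only: of_nat_le_iff)
      also have "\<dots> \<le> 2 * a (n - 3)"
        using IH(2)[of "n - 3"] n by simp
      finally show ?thesis .
    qed
    moreover have "a n = 3 * a (n - 1) + 5 * a (n - 3)
        - (\<Sum>i\<in>{6..n}. D_coeff i * a (n - i)) - int n * D_coeff n"
      using divisor_sum_recurrence[OF assms(1), of n]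
      by (simp add: sum_atMost_6[OF n] D_coeff_values a_def)
    ultimately have "3 * a (n - 1) \<le> a n"
      using nonneg[of "n - 3"] n by linarith
    moreover have "3 ^ n \<le> 3 * a (n - 1)"
      using IH(2)[of "n - 1"] n by (cases n) auto
    ultimately show ?thesis by (simp add: a_def)
  qed
qed

lemma divisor_sum_pos:
  assumes "product_exponents \<kappa>" "n > 0"
  shows "weighted_divisor_sum \<kappa> n > 0"
  using divisor_sum_growth[OF assms] zero_less_power[of "3::int" n] by linarith

lemma sum_divisor_sum_le:
  assumes "product_exponents \<kappa>"
  shows "(\<Sum>d\<in>{1..m}. weighted_divisor_sum \<kappa> d) \<le> 2 * weighted_divisor_sum \<kappa> m"
proof (induction m)
  case (Suc m)
  have "3 * weighted_divisor_sum \<kappa> m \<le> weighted_divisor_sum \<kappa> (Suc m)"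
    using divisor_sum_growth[OF assms, of "Suc m"] by simp
  moreover have "0 \<le> weighted_divisor_sum \<kappa> m"
    using divisor_sum_pos[OF assms, of m] by (cases "m = 0") auto
  ultimately show ?case using Suc by simp
qed simp

text \<open>
  The contribution of the proper divisors is controlled by \<open>d \<kappa>(d) \<le> a(d)\<close>, which itself relies on the
  positivity of the smaller exponents; hence the joint induction.
\<close>

lemma exponent_pos_and_approx:
  assumes "product_exponents \<kappa>" "r > 0"
  shows "\<kappa> r > 0 \<and> int r * \<kappa> r \<le> weighted_divisor_sum \<kappa> r
    \<and> weighted_divisor_sum \<kappa> r \<le> int r * \<kappa> r + 2 * weighted_divisor_sum \<kappa> (r div 2)"
  using assms(2)
proof (induction r rule: less_induct)
  case (less r)
  let ?a = "weighted_divisor_sum \<kappa>"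
  define S where "S = (\<Sum>d | d \<in> {1..r div 2} \<and> d dvd r. int d * \<kappa> d)"
  have IH: "0 < \<kappa> d" "int d * \<kappa> d \<le> ?a d" if "d \<in> {1..r div 2}" for d
    using less.IH[of d] that less.prems by auto
  have split: "?a r = int r * \<kappa> r + S"
    unfolding S_def by (rule weighted_divisor_sum_split) fact
  have S0: "0 \<le> S"
    unfolding S_def using IH(1) by (intro sum_nonneg) (simp add: less_imp_le)
  have "S \<le> (\<Sum>d\<in>{1..r div 2}. int d * \<kappa> d)"
    unfolding S_def using IH(1) by (intro sum_mono2) (auto simp: less_imp_le)
  also have "\<dots> \<le> (\<Sum>d\<in>{1..r div 2}. ?a d)"
    using IH(2) by (rule sum_mono)
  also have "\<dots> \<le> 2 * ?a (r div 2)"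
    by (rule sum_divisor_sum_le) fact
  finally have S2: "S \<le> 2 * ?a (r div 2)" .
  have "2 * ?a (r div 2) < ?a r"
  proof (cases "r = 1")
    case True
    then show ?thesis using divisor_sum_pos[OF assms(1), of r] by simp
  next
    case False
    have "?a (r div 2) \<le> ?a (r - 1)"
    proof -
      have "?a i \<le> ?a j" if "i \<le> j" "0 < i" for i j
        using that
      proof (induction j rule: dec_induct)
        case (step j)
        then show ?case
          using divisor_sum_growth[OF assms(1), of "Suc j"] divisor_sum_pos[OF assms(1), of j] by simp
      qed simp
      then show ?thesis using False less.prems by simp
    qed
    then show ?thesis
      using divisor_sum_growth[OF assms(1), of r] divisor_sum_pos[OF assms(1), of "r - 1"]
        False less.prems by simp
  qed
  with S2 split have "0 < int r * \<kappa> r" by linarith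
  then have "0 < \<kappa> r" by (simp add: zero_less_mult_iff)
  with S0 S2 split show ?case by linarith
qed

lemma kappa_values: "map kappa [1..<9] = [3, 3, 13, 33, 93, 254, 771, 2292]"
proof -
  note a = divisor_sum_values[OF product_exponents_kappa]
  have split: "weighted_divisor_sum kappa n
      = int n * kappa n + (\<Sum>d\<in>set [1..<Suc (n div 2)]. if d dvd n then int d * kappa d else 0)"
    if "n > 0" for n
  proof -
    have "{d. d \<in> {1..n div 2} \<and> d dvd n} = {d \<in> set [1..<Suc (n div 2)]. d dvd n}"
      by auto
    then show ?thesis
      unfolding weighted_divisor_sum_split[OF that] by (simp only: sum.inter_filter[OF finite_set])
  qed
  have k1: "kappa (Suc 0) = 3" using a(1) split[of "Suc 0"] by simp
  have k2: "kappa 2 = 3" using a(2) split[of 2] by (simp add: k1)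
  have k3: "kappa 3 = 13" using a(3) split[of 3] by (simp add: k1 k2)
  have k4: "kappa 4 = 33" using a(4) split[of 4] by (simp add: upt_rec k1 k2 k3 flip: numeral_2_eq_2)
  have k5: "kappa 5 = 93" using a(5) split[of 5] by (simp add: upt_rec k1 k2 k3 flip: numeral_2_eq_2)
  have k6: "kappa 6 = 254" using a(6) split[of 6] by (simp add: upt_rec k1 k2 k3 k4 flip: numeral_2_eq_2)
  have k7: "kappa 7 = 771" using a(7) split[of 7] by (simp add: upt_rec k1 k2 k3 k4 flip: numeral_2_eq_2)
  have k8: "kappa 8 = 2292" using a(8) split[of 8] by (simp add: upt_rec k1 k2 k3 k4 flip: numeral_2_eq_2)
  show ?thesis
    by (simp add: upt_rec k1 k2 k3 k4 k5 k6 k7 k8 flip: numeral_2_eq_2)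
qed

section \<open>The zero of \<open>D\<close> in the disc of radius one half\<close>

lemma abs_real_D_coeff_le: "\<bar>real_of_int (D_coeff n)\<bar> \<le> real n + 2"
proof -
  have "real_of_int \<bar>D_coeff n\<bar> \<le> real_of_int (int n + 2)"
    using abs_D_coeff_le unfolding of_int_le_iff .
  then show ?thesis by simp
qed

lemma fps_conv_radius_D: "fps_conv_radius (D_fps :: complex fps) \<ge> 1"
  unfolding fps_conv_radius_def
proof (rule conv_radius_geI_ex')
  fix r :: real assume r: "0 < r" "ereal r < 1"
  have "summable (\<lambda>n. 2 * (of_nat (Suc n) * r ^ n))"
    using r geometric_deriv_sums[of r] by (intro summable_mult) (auto simp: sums_iff)
  then show "summable (\<lambda>n. fps_nth D_fps n * complex_of_real r ^ n)"
  proof (rule summable_comparison_test')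
    fix n
    have "norm (fps_nth D_fps n :: complex) = \<bar>real_of_int (D_coeff n)\<bar>"
      by (simp add: D_fps_nth norm_of_int)
    also have "\<dots> \<le> 2 * real (Suc n)"
      by (rule order_trans[OF abs_real_D_coeff_le]) simp
    finally show "norm (fps_nth D_fps n * complex_of_real r ^ n) \<le> 2 * (of_nat (Suc n) * r ^ n)"
      using r by (simp add: norm_mult norm_power mult_right_mono flip: mult.assoc)
  qed
qed

lemma D_fun_sums:
  assumes "norm z < 1"
  shows "(\<lambda>n. of_int (D_coeff n) * z ^ n) sums D_fun z"
proof -
  have "ereal (norm z) < fps_conv_radius (D_fps :: complex fps)"
    using assms by (intro less_le_trans[OF _ fps_conv_radius_D]) simp
  from sums_eval_fps[OF this] show ?thesis
    by (simp add: D_fun_def D_fps_nth)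
qed

lemma D_fun_holomorphic: "D_fun holomorphic_on ball 0 1"
proof -
  have "ball 0 1 \<subseteq> eball 0 (fps_conv_radius (D_fps :: complex fps))"
    using less_le_trans[OF _ fps_conv_radius_D] by fastforce
  then show ?thesis
    unfolding D_fun_def[abs_def] by (rule holomorphic_on_eval_fps)
qed

lemma D_fun_has_fps_expansion: "D_fun has_fps_expansion D_fps"
  unfolding D_fun_def[abs_def]
  by (intro eval_fps_has_fps_expansion less_le_trans[OF _ fps_conv_radius_D]) simp

text \<open>
  Both sides expand by \<open>x^n - y^n = (x - y) \<Sum>i x^i y^(n-1-i)\<close>, and the sum is monotone in the moduli.
\<close>

lemma norm_power_diff_le:
  fixes z w :: complex
  assumes "norm z \<le> s" "norm w \<le> a" "a < s"
  shows "norm (z ^ n - w ^ n) * (s - a) \<le> norm (z - w) * (s ^ n - a ^ n)"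
proof -
  have "0 \<le> a" "0 \<le> s"
    using assms norm_ge_zero[of w] by linarith+
  then have le: "norm (w ^ (n - Suc i) * z ^ i) \<le> a ^ (n - Suc i) * s ^ i" for i
    using assms unfolding norm_mult norm_power by (intro mult_mono power_mono) auto
  have "norm (z ^ n - w ^ n) \<le> norm (z - w) * (\<Sum>i<n. a ^ (n - Suc i) * s ^ i)"
    unfolding power_diff_sumr2[of z] norm_mult
    by (intro mult_left_mono order_trans[OF norm_sum] sum_mono le) auto
  then have "norm (z ^ n - w ^ n) * (s - a)
      \<le> norm (z - w) * (\<Sum>i<n. a ^ (n - Suc i) * s ^ i) * (s - a)"
    using assms by (intro mult_right_mono) auto
  then show ?thesis
    unfolding power_diff_sumr2[of s] by (simp add: mult_ac)
qed

lemma norm_series_tail_le: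
  fixes f :: "nat \<Rightarrow> 'a::banach"
  assumes "f sums S" "\<And>n. n \<ge> N \<Longrightarrow> norm (f n) \<le> C * q ^ n" "0 \<le> q" "q < 1"
  shows "norm (S - (\<Sum>n<N. f n)) \<le> C * q ^ N / (1 - q)"
proof -
  have f: "(\<lambda>n. f (n + N)) sums (S - (\<Sum>n<N. f n))"
    using assms(1) by (rule sums_split_initial_segment)
  have g: "(\<lambda>n. C * q ^ N * q ^ n) sums (C * q ^ N * (1 / (1 - q)))"
    using assms by (intro sums_mult geometric_sums) auto
  have "norm (\<Sum>n. f (n + N)) \<le> (\<Sum>n. C * q ^ N * q ^ n)"
  proof (rule norm_suminf_le)
    show "norm (f (n + N)) \<le> C * q ^ N * q ^ n" for n
      using assms(2)[of "n + N"] by (simp add: power_add mult_ac)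
  qed (use g in \<open>simp add: sums_iff\<close>)
  with f g show ?thesis by (simp add: sums_iff)
qed

text \<open>
  A geometric majorant for the terms that are not treated explicitly. The ratio \<open>5/4\<close> is large enough
  to dominate \<open>n + 2\<close> from the triangular number \<open>15\<close> on, and small enough that for \<open>|z| \<le> 1/2\<close> the
  tail is of the order of \<open>(5/8)^15\<close>.
\<close>

lemma abs_D_coeff_le_power:
  assumes "n \<ge> 15"
  shows "\<bar>real_of_int (D_coeff n)\<bar> \<le> (5 / 4) ^ n"
proof -
  have "real n + 2 \<le> (5 / 4) ^ n"
    using assms
  proof (induction n rule: dec_induct)
    case base
    show ?case by (simp add: power_divide)
  qed simp
  then show ?thesis
    using abs_real_D_coeff_le[of n] by linarith
qed

lemma sum_lessThan_15_D:
  "(\<Sum>n<15. of_int (D_coeff n) * x n) = x 0 - 3 * x 1 - 5 * x 3 + 7 * x 6 + 9 * (x 10 :: 'a::comm_ring_1)"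
  by (simp add: lessThan_nat_numeral D_coeff_values)

text \<open>
  With \<open>c(n)\<close> the coefficients of \<open>D\<close>, \<open>D(z) - D(w) = -3 (z - w) + \<Sum>n\<ge>3. c(n) (z^n - w^n)\<close>, and the
  sum is at most \<open>|z - w| \<Sum>n\<ge>3. |c(n)| ((1/2)^n - (293/1000)^n) / (1/2 - 293/1000)\<close>. The factor
  of \<open>|z - w|\<close> is about \<open>2.963\<close>, just below \<open>3\<close>. There is little room for a larger radius: with
  \<open>31/100\<close> in place of \<open>293/1000\<close> the factor would exceed \<open>3\<close>.
\<close>

lemma D_fun_diff_bound:
  assumes "norm z \<le> 1 / 2" "norm w \<le> 293 / 1000"
  shows "norm (z - w) \<le> 50 * norm (D_fun z - D_fun w)"
proof -
  define d where "d = norm (z - w)"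
  define x where "x n = z ^ n - w ^ n" for n
  have x: "norm (x n) \<le> d * (((1 / 2) ^ n - (293 / 1000) ^ n) * (1000 / 207))" for n
    using norm_power_diff_le[OF assms, of n] by (simp add: x_def d_def field_simps)
  have "(\<lambda>n. of_int (D_coeff n) * x n) sums (D_fun z - D_fun w)"
    unfolding x_def right_diff_distrib using assms by (intro sums_diff D_fun_sums) auto
  then have tail: "norm (D_fun z - D_fun w - (\<Sum>n<15. of_int (D_coeff n) * x n))
      \<le> d * (1000 / 207) * (5 / 8) ^ 15 / (1 - 5 / 8)"
  proof (rule norm_series_tail_le)
    fix n :: nat assume n: "n \<ge> 15"
    have "norm (of_int (D_coeff n) * x n) = \<bar>real_of_int (D_coeff n)\<bar> * norm (x n)"
      by (simp add: norm_mult)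
    also have "\<dots> \<le> (5 / 4) ^ n * (d * ((1 / 2) ^ n * (1000 / 207)))"
    proof (intro mult_mono abs_D_coeff_le_power n)
      show "norm (x n) \<le> d * ((1 / 2) ^ n * (1000 / 207))"
        by (rule order_trans[OF x]) (auto simp: d_def intro!: mult_left_mono)
    qed auto
    also have "\<dots> = d * (1000 / 207) * ((5 / 4) ^ n * (1 / 2) ^ n)"
      by simp
    also have "(5 / 4 :: real) ^ n * (1 / 2) ^ n = (5 / 8) ^ n"
      by (simp flip: power_mult_distrib)
    finally show "norm (of_int (D_coeff n) * x n) \<le> d * (1000 / 207) * (5 / 8) ^ n" .
  qed auto
  define t where "t = D_fun z - D_fun w - (\<Sum>n<15. of_int (D_coeff n) * x n)"
  have "3 * (z - w) = t - (D_fun z - D_fun w) + (- 5 * x 3 + (7 * x 6 + 9 * x 10))"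
    unfolding t_def sum_lessThan_15_D by (simp add: x_def)
  then have "norm (3 * (z - w)) \<le> norm (t - (D_fun z - D_fun w))
      + (norm (- 5 * x 3) + (norm (7 * x 6) + norm (9 * x 10)))"
    by (metis norm_triangle_mono order_refl norm_triangle_ineq)
  also have "norm (t - (D_fun z - D_fun w)) \<le> norm t + norm (D_fun z - D_fun w)"
    by (rule norm_triangle_ineq4)
  finally have "3 * d \<le> norm t + norm (D_fun z - D_fun w)
      + (5 * norm (x 3) + (7 * norm (x 6) + 9 * norm (x 10)))"
    unfolding norm_mult by (simp add: d_def)
  moreover have "norm t \<le> d * (12 / 1000)"
  proof -
    have "d * (1000 / 207) * (5 / 8) ^ 15 / (1 - 5 / 8) = d * (1000 / 207 * (5 / 8) ^ 15 / (1 - 5 / 8))"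
      by simp
    also have "\<dots> \<le> d * (12 / 1000)"
      by (intro mult_left_mono) (auto simp: d_def power_divide)
    finally show ?thesis using tail by (simp add: t_def)
  qed
  moreover have "norm (x 3) \<le> d * (4824 / 10000)"
    by (rule order_trans[OF x]) (intro mult_left_mono, auto simp: d_def power_divide)
  moreover have "norm (x 6) \<le> d * (725 / 10000)"
    by (rule order_trans[OF x]) (intro mult_left_mono, auto simp: d_def power_divide)
  moreover have "norm (x 10) \<le> d * (475 / 100000)"
    by (rule order_trans[OF x]) (intro mult_left_mono, auto simp: d_def power_divide)
  moreover have "0 \<le> norm (D_fun z - D_fun w)"
    by (rule norm_ge_zero)
  \<comment> \<open>\<open>5 * 0.4824 + 7 * 0.0725 + 9 * 0.00475 + 0.012 < 2.98\<close>, which leaves \<open>0.02 d\<close> for \<open>|D z - D w|\<close>.\<close>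
  ultimately show ?thesis
    unfolding d_def[symmetric] by linarith
qed

lemma D_fun_of_real:
  assumes "\<bar>x\<bar> < 1"
  shows "(\<lambda>n. of_int (D_coeff n) * x ^ n) sums Re (D_fun (of_real x))"
    and "Im (D_fun (of_real x)) = 0"
proof -
  have "(\<lambda>n. of_int (D_coeff n) * complex_of_real x ^ n) sums D_fun (of_real x)"
    using assms by (intro D_fun_sums) simp
  then have sums: "(\<lambda>n. complex_of_real (of_int (D_coeff n) * x ^ n)) sums D_fun (of_real x)"
    by simp
  show "(\<lambda>n. of_int (D_coeff n) * x ^ n) sums Re (D_fun (of_real x))"
    using sums_Re[OF sums] by (simp only: Re_complex_of_real)
  have "(\<lambda>n. 0) sums Im (D_fun (of_real x))"
    using sums_Im[OF sums] by (simp only: Im_complex_of_real)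
  then show "Im (D_fun (of_real x)) = 0"
    by (rule sums_unique2[OF _ sums_zero])
qed

text \<open>
  \<open>D(0) = 1\<close>, and \<open>D(293/1000)\<close> is about \<open>-0.0003\<close>. So tight a margin requires all terms of
  index below \<open>15\<close>; the rest is bounded by a geometric series.
\<close>

lemma D_fun_real_zero:
  obtains x where "0 < x" "x \<le> 293 / 1000" "D_fun (complex_of_real x) = 0"
proof -
  have zero: "D_fun 0 = 1"
    by (simp add: D_fun_def eval_fps_at_0)
  define b :: real where "b = 293 / 1000"
  have b: "0 < b" "b < 4 / 5"
    by (simp_all add: b_def)
  have neg: "Re (D_fun (of_real b)) < 0"
  proof -
    have "(\<lambda>n. of_int (D_coeff n) * b ^ n) sums Re (D_fun (of_real b))"
      using b by (intro D_fun_of_real) simp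
    then have "norm (Re (D_fun (of_real b)) - (\<Sum>n<15. of_int (D_coeff n) * b ^ n))
        \<le> 1 * (5 / 4 * b) ^ 15 / (1 - 5 / 4 * b)"
    proof (rule norm_series_tail_le)
      fix n :: nat assume "n \<ge> 15"
      then have "\<bar>real_of_int (D_coeff n)\<bar> * b ^ n \<le> (5 / 4) ^ n * b ^ n"
        using b by (intro mult_right_mono abs_D_coeff_le_power) auto
      then show "norm (of_int (D_coeff n) * b ^ n) \<le> 1 * (5 / 4 * b) ^ n"
        unfolding power_mult_distrib using b by (simp add: abs_mult)
    qed (use b in auto)
    then have "Re (D_fun (of_real b)) \<le> (\<Sum>n<15. of_int (D_coeff n) * b ^ n)
         + (5 / 4 * b) ^ 15 / (1 - 5 / 4 * b)"
      unfolding real_norm_def by linarith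
    also have "\<dots> < 0"
      unfolding sum_lessThan_15_D b_def by (simp add: power_divide)
    finally show ?thesis .
  qed
  have cont: "continuous_on (ball 0 1) D_fun"
    by (intro holomorphic_on_imp_continuous_on D_fun_holomorphic)
  have "continuous_on {0..b} (\<lambda>x. complex_of_real x)"
    by (intro continuous_intros)
  then have "continuous_on {0..b} (\<lambda>x. D_fun (of_real x))"
    by (rule continuous_on_compose2[OF cont]) (use b in auto)
  then have "continuous_on {0..b} (\<lambda>x. Re (D_fun (of_real x)))"
    by (rule continuous_on_Re)
  then have "\<exists>x. 0 \<le> x \<and> x \<le> b \<and> Re (D_fun (of_real x)) = 0"
    using neg zero b by (intro IVT2') auto
  then obtain x where x: "0 \<le> x" "x \<le> b" "Re (D_fun (of_real x)) = 0"
    by blast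
  show ?thesis
  proof (rule that)
    show "D_fun (of_real x) = 0"
      using x b D_fun_of_real(2)[of x] by (simp add: complex_eq_iff)
    then have "x \<noteq> 0" using zero by auto
    then show "0 < x" using x by simp
  qed (use x b_def in auto)
qed

lemma q0_zero: "D_fun (of_real q0) = 0" and q0_pos: "0 < q0" and q0_le: "q0 \<le> 293 / 1000"
proof -
  obtain x where x: "0 < x" "x \<le> 293 / 1000" "D_fun (complex_of_real x) = 0"
    by (rule D_fun_real_zero)
  have "z = of_real x" if "norm z < 1 / 2" "D_fun z = 0" for z
    using D_fun_diff_bound[of z "of_real x"] that x by simp
  then have "{z. norm z < 1 / 2 \<and> D_fun z = 0} = {complex_of_real x}"
    using x by auto
  then have "q0 = x"
    unfolding q0_def by (intro the_equality) auto
  with x show "D_fun (of_real q0) = 0" "0 < q0" "q0 \<le> 293 / 1000" by simp_all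
qed

text \<open>The bound \<open>|z - q0| \<le> 50 |D(z) - D(q0)|\<close> passes to the limit as \<open>|D'(q0)| \<ge> 1/50\<close>.\<close>

lemma deriv_D_fun_q0: "deriv D_fun (of_real q0) \<noteq> 0"
proof -
  let ?q = "complex_of_real q0"
  have q: "norm ?q \<le> 293 / 1000" "norm ?q < 1 / 2"
    using q0_pos q0_le by auto
  have "(D_fun has_field_derivative deriv D_fun ?q) (at ?q)"
    using q by (intro holomorphic_derivI[OF D_fun_holomorphic]) auto
  then have "((\<lambda>z. norm ((D_fun z - D_fun ?q) / (z - ?q))) \<longlongrightarrow> norm (deriv D_fun ?q)) (at ?q)"
    unfolding has_field_derivative_iff by (rule tendsto_norm)
  moreover have "\<forall>\<^sub>F z in at ?q. 1 / 50 \<le> norm ((D_fun z - D_fun ?q) / (z - ?q))"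
  proof -
    have "\<forall>\<^sub>F z in at ?q. z \<in> ball 0 (1 / 2) - {?q}"
      using q by (intro eventually_at_in_open) auto
    then show ?thesis
    proof eventually_elim
      case (elim z)
      then have "norm (z - ?q) \<le> 50 * norm (D_fun z - D_fun ?q)"
        using q by (intro D_fun_diff_bound) auto
      with elim show ?case
        by (simp add: norm_divide field_simps)
    qed
  qed
  ultimately have "1 / 50 \<le> norm (deriv D_fun ?q)"
    by (rule tendsto_lowerbound) simp
  then show ?thesis by auto
qed

section \<open>Asymptotics of the divisor sums and of the exponents\<close>

lemma R_star_zero:
  assumes "norm z < 1" "D_fun z = 0" "z \<noteq> of_real q0"
  shows "R_star \<le> ereal (norm z)"
  unfolding R_star_def using assms by (intro min.coboundedI2 INF_lower) auto

lemma eball_R_star_subset: "eball 0 R_star \<subseteq> ball (0::complex) 1"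
proof
  fix z :: complex assume "z \<in> eball 0 R_star"
  then have "ereal (norm z) < R_star" by simp
  also have "R_star \<le> 1"
    unfolding R_star_def by (rule min.cobounded1)
  finally show "z \<in> ball 0 1" by simp
qed

text \<open>
  The difference quotient of \<open>D\<close> at \<open>q0\<close>. It is nonzero at \<open>q0\<close> because the zero is simple, and
  elsewhere because every other zero in the unit disc has modulus at least \<open>R_star\<close>.
\<close>

lemma D_fun_cofactor:
  obtains h where "h holomorphic_on ball 0 1"
    "\<And>z. z \<in> ball 0 1 \<Longrightarrow> D_fun z = (z - of_real q0) * h z"
    "\<And>z. z \<in> eball 0 R_star \<Longrightarrow> h z \<noteq> 0"
proof
  define h where "h z = (if z = of_real q0 then deriv D_fun (of_real q0)
    else (D_fun z - D_fun (of_real q0)) / (z - of_real q0))" for z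
  show "h holomorphic_on ball 0 1"
    unfolding h_def[abs_def] using q0_pos q0_le
    by (intro pole_lemma D_fun_holomorphic) (auto simp: interior_open)
  show "D_fun z = (z - of_real q0) * h z" for z
    using q0_zero by (simp add: h_def)
  show "h z \<noteq> 0" if "z \<in> eball 0 R_star" for z
  proof -
    have "norm z < 1" "ereal (norm z) < R_star"
      using that eball_R_star_subset by auto
    then show ?thesis
      using R_star_zero[of z] deriv_D_fun_q0 q0_zero by (auto simp: h_def)
  qed
qed

text \<open>
  The factorization \<open>D = (z - q0) h\<close> splits the logarithmic derivative into \<open>\<Sum>n\<ge>1. (z/q0)^n\<close> and
  \<open>-z h'/h\<close>. The latter is holomorphic on the disc of radius \<open>R_star\<close>, so its Taylor coefficients are
  \<open>O(R^(-n))\<close>.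
\<close>

lemma divisor_sum_asymptotics:
  assumes "product_exponents \<kappa>" "0 < R" "ereal R < R_star"
  obtains C where "\<And>n. n > 0 \<Longrightarrow>
    \<bar>real_of_int (weighted_divisor_sum \<kappa> n) - 1 / q0 ^ n\<bar> \<le> C / R ^ n"
proof -
  obtain h where h: "h holomorphic_on ball 0 1"
      "\<And>z. z \<in> ball 0 1 \<Longrightarrow> D_fun z = (z - of_real q0) * h z"
      "\<And>z. z \<in> eball 0 R_star \<Longrightarrow> h z \<noteq> 0"
    by (rule D_fun_cofactor) blast
  have pos: "0 < R_star"
    using assms(2,3) by (meson ereal_less(2) less_trans)
  define B where "B z = - (z * deriv h z) * inverse (h z)" for z
  have h': "h holomorphic_on eball 0 R_star"
    using h(1) eball_R_star_subset by (rule holomorphic_on_subset)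
  have B: "B holomorphic_on eball 0 R_star"
    unfolding B_def[abs_def] using h(3)
    by (intro holomorphic_on_mult holomorphic_on_minus holomorphic_on_ident holomorphic_on_inverse
          holomorphic_deriv h' open_eball) auto
  define H where "H = fps_expansion h 0"
  define G where "G = fps_expansion B 0"
  have H: "h has_fps_expansion H"
    unfolding H_def using h(1) by (intro has_fps_expansion_fps_expansion[of "ball 0 1"]) auto
  have G: "B has_fps_expansion G"
    unfolding G_def using B pos
    by (intro has_fps_expansion_fps_expansion[of "eball 0 R_star"]) (auto simp: zero_ereal_def)
  have "fps_nth H 0 = h 0"
    by (simp add: H_def fps_expansion_def)
  then have H0: "fps_nth H 0 \<noteq> 0"
    using h(3)[of 0] pos by (simp add: zero_ereal_def)
  have "B has_fps_expansion - (fps_X * fps_deriv H) * inverse H"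
    unfolding B_def[abs_def] by (intro fps_expansion_intros H H0)
  with G have "G = - (fps_X * fps_deriv H) * inverse H"
    by (rule fps_expansion_unique_complex)
  then have "H * G = - (fps_X * fps_deriv H) * (inverse H * H)"
    by simp
  then have "neg_log_deriv H G"
    using inverse_mult_eq_1[OF H0] by (simp add: neg_log_deriv_def)
  moreover have "D_fps = (fps_X - fps_const (of_real q0)) * H"
  proof (rule fps_expansion_unique_complex[OF D_fun_has_fps_expansion])
    have "(\<lambda>z. (z - of_real q0) * h z) has_fps_expansion (fps_X - fps_const (of_real q0)) * H"
      by (intro fps_expansion_intros H)
    moreover have "\<forall>\<^sub>F z in nhds 0. D_fun z = (z - of_real q0) * h z"
    proof -
      have "\<forall>\<^sub>F z :: complex in nhds 0. z \<in> ball 0 1"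
        by (intro eventually_nhds_in_open) auto
      then show ?thesis
        by eventually_elim (rule h(2))
    qed
    ultimately show "D_fun has_fps_expansion (fps_X - fps_const (of_real q0)) * H"
      by (subst has_fps_expansion_cong[OF _ refl])
  qed
  ultimately have "neg_log_deriv D_fps
      (Abs_fps (\<lambda>n. if n = 0 then 0 else 1 / complex_of_real q0 ^ n) + G)"
    using q0_pos by (metis neg_log_deriv_mult neg_log_deriv_linear_factor of_real_eq_0_iff less_irrefl)
  with neg_log_deriv_D[OF assms(1)]
  have "divisor_sum_fps \<kappa> = Abs_fps (\<lambda>n. if n = 0 then 0 else 1 / complex_of_real q0 ^ n) + G"
    by (rule neg_log_deriv_unique) (rule D_fps_nonzero)
  then have eq: "of_int (weighted_divisor_sum \<kappa> n) = 1 / complex_of_real q0 ^ n + fps_nth G n"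
    if "n > 0" for n
    using that by (auto simp: divisor_sum_fps_def fps_eq_iff)
  have "R_star \<le> fps_conv_radius G"
    unfolding G_def using B by (rule conv_radius_fps_expansion)
  with assms have "summable (\<lambda>n. norm (fps_nth G n * complex_of_real R ^ n))"
    by (intro norm_summable_fps less_le_trans[of _ R_star "fps_conv_radius G"]) simp_all
  then obtain C where C: "\<And>n. norm (fps_nth G n * complex_of_real R ^ n) \<le> C"
    using summable_imp_Bseq[THEN BseqD] by fastforce
  show ?thesis
  proof (rule that)
    fix n :: nat assume n: "n > 0"
    have "complex_of_real (real_of_int (weighted_divisor_sum \<kappa> n) - 1 / q0 ^ n) = fps_nth G n"
      using eq[OF n] by simp
    then have "\<bar>real_of_int (weighted_divisor_sum \<kappa> n) - 1 / q0 ^ n\<bar> = norm (fps_nth G n)"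
      by (metis norm_of_real)
    also have "\<dots> \<le> C / R ^ n"
      using C[of n] assms(2) by (simp add: norm_mult norm_power field_simps)
    finally show "\<bar>real_of_int (weighted_divisor_sum \<kappa> n) - 1 / q0 ^ n\<bar> \<le> C / R ^ n" .
  qed
qed

text \<open>
  Two errors occur in \<open>r \<kappa>(r) = q0^(-r) + \<dots>\<close>: the Taylor coefficients of \<open>-z h'/h\<close>, of size
  \<open>R^(-r)\<close>, and the proper divisors, of size \<open>q0^(-r/2)\<close>. The two lower bounds on \<open>\<rho>\<close> absorb one
  each.
\<close>

lemma kappa_asymptotics:
  assumes "1 / 2 < R" "ereal R < R_star" "max (1 / R) (q0 powr (- 1 / 2)) < \<rho>"
  shows "(\<lambda>r. real_of_int (kappa r) - q0 powi (- int r) / real r) \<in> O(\<lambda>r. \<rho> ^ r / real r)"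
proof -
  let ?a = "\<lambda>n. real_of_int (weighted_divisor_sum kappa n)"
  obtain C where C: "\<And>n. n > 0 \<Longrightarrow> \<bar>?a n - 1 / q0 ^ n\<bar> \<le> C / R ^ n"
    using divisor_sum_asymptotics[OF product_exponents_kappa, of R] assms by auto
  have C0: "0 \<le> C"
    using order_trans[OF abs_ge_zero C[of 1]] assms(1) by (simp add: zero_le_divide_iff)
  have \<rho>R: "1 / R < \<rho>" and \<rho>q: "q0 powr (- 1 / 2) < \<rho>"
    using assms(3) by auto
  have "1 \<le> q0 powr (- 1 / 2)"
    using q0_pos q0_le powr_mono2'[of "- 1 / 2" q0 1] by simp
  with \<rho>q have \<rho>1: "1 < \<rho>" by linarith
  have \<rho>2: "1 / q0 \<le> \<rho>\<^sup>2"
  proof -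
    have "1 / q0 = (q0 powr (- 1 / 2))\<^sup>2"
      using q0_pos by (simp add: powr_minus_divide powr_half_sqrt power_divide)
    also have "\<dots> \<le> \<rho>\<^sup>2"
      using \<rho>q by (intro power_mono) auto
    finally show ?thesis .
  qed
  \<comment> \<open>As \<open>q0 < 1/2 < R\<close>, the error \<open>C / R^m\<close> is dominated by \<open>q0^(-m)\<close>, and \<open>q0^(-m) \<le> \<rho>^(2m) \<le> \<rho>^r\<close>.\<close>
  have half: "?a (r div 2) \<le> (1 + C) * \<rho> ^ r" for r
  proof (cases "r div 2 = 0")
    case True
    then show ?thesis using C0 \<rho>1 by simp
  next
    case False
    define m where "m = r div 2"
    have "q0 ^ m \<le> R ^ m"
      using q0_pos q0_le assms(1) by (intro power_mono) auto
    then have "C / R ^ m \<le> C * (1 / q0 ^ m)"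
      using C0 q0_pos assms(1) by (simp add: divide_left_mono)
    then have "?a m \<le> (1 + C) * (1 / q0) ^ m"
    proof -
      have "?a m \<le> 1 / q0 ^ m + C / R ^ m"
        using C[of m] False unfolding m_def by linarith
      also have "\<dots> \<le> 1 / q0 ^ m + C * (1 / q0 ^ m)"
        using \<open>C / R ^ m \<le> C * (1 / q0 ^ m)\<close> by simp
      also have "\<dots> = (1 + C) * (1 / q0) ^ m"
        by (simp add: power_divide add_divide_distrib)
      finally show ?thesis .
    qed
    also have "\<dots> \<le> (1 + C) * (\<rho>\<^sup>2) ^ m"
      using C0 q0_pos \<rho>2 by (intro mult_left_mono power_mono) auto
    also have "(\<rho>\<^sup>2) ^ m \<le> \<rho> ^ r"
      using \<rho>1 by (simp add: m_def flip: power_mult)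
    finally show ?thesis using C0 by (simp add: m_def)
  qed
  have bound: "\<bar>real r * real_of_int (kappa r) - 1 / q0 ^ r\<bar> \<le> (2 + 3 * C) * \<rho> ^ r" if "r > 0" for r
  proof -
    have "real_of_int (int r * kappa r) \<le> ?a r"
      "?a r \<le> real_of_int (int r * kappa r + 2 * weighted_divisor_sum kappa (r div 2))"
      using exponent_pos_and_approx[OF product_exponents_kappa that]
      by (simp_all only: of_int_le_iff)
    then have "\<bar>real r * real_of_int (kappa r) - ?a r\<bar> \<le> 2 * ?a (r div 2)"
      by simp
    moreover have "C / R ^ r \<le> C * \<rho> ^ r"
    proof -
      have "(1 / R) ^ r \<le> \<rho> ^ r"
        using \<rho>R assms(1) by (intro power_mono) auto
      then show ?thesis
        using mult_left_mono[OF _ C0] by (fastforce simp: power_divide)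
    qed
    ultimately show ?thesis
      using C[OF that] half[of r] by (simp add: algebra_simps)
  qed
  show ?thesis
  proof (rule bigoI)
    show "\<forall>\<^sub>F r in sequentially. norm (real_of_int (kappa r) - q0 powi (- int r) / real r)
        \<le> (2 + 3 * C) * norm (\<rho> ^ r / real r)"
      using eventually_gt_at_top[of 0]
    proof eventually_elim
      case (elim r)
      have "q0 powi (- int r) = 1 / q0 ^ r"
        by (simp add: power_int_minus divide_inverse)
      then have "real_of_int (kappa r) - q0 powi (- int r) / real r
          = (real r * real_of_int (kappa r) - 1 / q0 ^ r) / real r"
        using elim by (simp add: field_simps)
      then have "norm (real_of_int (kappa r) - q0 powi (- int r) / real r)
          = \<bar>real r * real_of_int (kappa r) - 1 / q0 ^ r\<bar> / real r"
        by (simp add: abs_divide)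
      also have "\<dots> \<le> (2 + 3 * C) * \<rho> ^ r / real r"
        using bound[OF elim] by (rule divide_right_mono) simp
      finally show ?case
        using \<rho>1 by (simp add: abs_of_pos)
    qed
  qed
qed

theorem theorem8p1:
  shows "(\<exists>!\<kappa>. \<kappa> 0 = 0 \<and> product_exponents \<kappa>)
    \<and> (\<forall>r\<ge>1. kappa r > 0)
    \<and> map kappa [1..<9] = [3, 3, 13, 33, 93, 254, 771, 2292]
    \<and> (\<forall>R \<rho> :: real.
         1 / 2 < R \<longrightarrow> ereal R < R_star \<longrightarrow>
         max (1 / R) (q0 powr (- 1 / 2)) < \<rho> \<longrightarrow> \<rho> < 2 \<longrightarrow>
         (\<lambda>r. real_of_int (kappa r) - q0 powi (- int r) / real r) \<in> O(\<lambda>r. \<rho> ^ r / real r))"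
  using product_exponents_ex1 exponent_pos_and_approx[OF product_exponents_kappa]
    kappa_values kappa_asymptotics by auto

end
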